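(* Let $m=2k\ge2$ with $k\in\mathbb N$, and let $P_m:\mathbb R^2\to\mathbb R$, $P_m(x,y)=(x^2-y^2)^k$. Then, for every $p\in[1,\infty]$, \[ \|P_m\|_p=1,\qquad \|P_m\|_{\mathrm{BW}}^2=\frac{4^k}{\binom{2k}{k}}>1 . \] Consequently, the real Bombieri--Weyl comparison is never contractive in even degree, for any $p$: for every even $m\ge2$ and every $p\in[1,\infty]$, the inequality $\|P\|_{\mathrm{BW}}\le\|P\|_p$ fails for some real $m$-homogeneous polynomial $P$. Moreover, $\|P_m\|_{\mathrm{BW}}\sim(\pi k)^{1/4}$ as $k\to\infty$.
   Context: For a real $m$-homogeneous polynomial $P(x)=\sum_{|\alpha|=m}b_\alpha x^\alpha$ on $\mathbb R^n$, $\|P\|_{\mathrm{BW}}=\bigl(\sum_{|\alpha|=m}\frac{\alpha!}{m!}|b_\alpha|^2\bigr)^{1/2}$ (with $\alpha!=\prod_j\alpha_j!$), and $\|P\|_p=\sup\{|P(x)|:x\in\mathbb R^n,\ \|x\|_p\le1\}$ is the supremum norm on the unit ball of $\ell_p^n(\mathbb R)$. The symbol $\sim$ means that the ratio tends to $1$. *)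

theory Defs
  imports "HOL-Analysis.Analysis" "HOL-Library.Landau_Symbols" "HOL-Library.Extended_Real"
begin

definition multi_indices :: "nat \<Rightarrow> ('n::finite \<Rightarrow> nat) set" where
  "multi_indices m = {\<alpha>. (\<Sum>j\<in>UNIV. \<alpha> j) = m}"

definition monomial_fun :: "('n::finite \<Rightarrow> nat) \<Rightarrow> real ^ 'n \<Rightarrow> real" where
  "monomial_fun \<alpha> x = (\<Prod>j\<in>UNIV. (x $ j) ^ \<alpha> j)"

definition coeffs_of ::
  "nat \<Rightarrow> (real ^ 'n::finite \<Rightarrow> real) \<Rightarrow> (('n \<Rightarrow> nat) \<Rightarrow> real) \<Rightarrow> bool" where
  "coeffs_of m P b \<longleftrightarrow> (\<forall>\<alpha>. \<alpha> \<notin> multi_indices m \<longrightarrow> b \<alpha> = 0) \<and>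
     (\<forall>x. P x = (\<Sum>\<alpha>\<in>multi_indices m. b \<alpha> * monomial_fun \<alpha> x))"

definition hom_poly :: "nat \<Rightarrow> (real ^ 'n::finite \<Rightarrow> real) \<Rightarrow> bool" where
  "hom_poly m P \<longleftrightarrow> (\<exists>b. coeffs_of m P b)"

(* Well defined for homogeneous P: a polynomial function over the reals determines its
   coefficients, see coeffs_of_unique below. *)
definition hom_coeff ::
  "nat \<Rightarrow> (real ^ 'n::finite \<Rightarrow> real) \<Rightarrow> ('n \<Rightarrow> nat) \<Rightarrow> real" where
  "hom_coeff m P = (THE b. coeffs_of m P b)"

(* The degree m is an explicit argument because P is only a function. *)
definition bw_norm :: "nat \<Rightarrow> (real ^ 'n::finite \<Rightarrow> real) \<Rightarrow> real" where
  "bw_norm m P =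
     sqrt (\<Sum>\<alpha>\<in>multi_indices m.
       (\<Prod>j\<in>UNIV. fact (\<alpha> j)) / fact m * \<bar>hom_coeff m P \<alpha>\<bar>\<^sup>2)"

(* Intended for 1 \<le> p, with p = \<infinity> allowed; infnorm is the maximum norm. *)
definition lp_norm :: "ereal \<Rightarrow> real ^ 'n::finite \<Rightarrow> real" where
  "lp_norm p x =
     (if p = \<infinity> then infnorm x
      else (\<Sum>j\<in>UNIV. \<bar>x $ j\<bar> powr real_of_ereal p) powr (1 / real_of_ereal p))"

(* A real supremum, hence meaningful only for P bounded on the unit ball; this holds for
   every polynomial, the coordinates being bounded by 1 there. *)
definition lp_sup_norm :: "ereal \<Rightarrow> (real ^ 'n::finite \<Rightarrow> real) \<Rightarrow> real" where
  "lp_sup_norm p P = (SUP x\<in>{x. lp_norm p x \<le> 1}. \<bar>P x\<bar>)"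

definition diff_sq_pow :: "nat \<Rightarrow> real ^ 2 \<Rightarrow> real" where
  "diff_sq_pow k z = ((z $ 1)\<^sup>2 - (z $ 2)\<^sup>2) ^ k"

lemma finite_multi_indices: "finite (multi_indices m :: ('n::finite \<Rightarrow> nat) set)"
proof -
  have "multi_indices m \<subseteq> PiE (UNIV :: 'n set) (\<lambda>_. {..m})"
    by (auto simp: multi_indices_def intro: member_le_sum)
  then show ?thesis
    by (rule finite_subset) (intro finite_PiE, auto)
qed

lemma monomials_independent:
  fixes b :: "('n \<Rightarrow> nat) \<Rightarrow> real"
  assumes "finite S" "finite A"
    and "\<forall>\<alpha>\<in>A. \<forall>\<beta>\<in>A. (\<forall>j\<in>S. \<alpha> j = \<beta> j) \<longrightarrow> \<alpha> = \<beta>"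
    and "\<forall>x::'n \<Rightarrow> real. (\<Sum>\<alpha>\<in>A. b \<alpha> * (\<Prod>j\<in>S. x j ^ \<alpha> j)) = 0"
  shows "\<forall>\<alpha>\<in>A. b \<alpha> = 0"
  using assms
proof (induction S arbitrary: A rule: finite_induct)
  case empty
  show ?case
  proof
    fix \<alpha> assume "\<alpha> \<in> A"
    then have "A = {\<alpha>}" using empty.prems(2) by auto
    then show "b \<alpha> = 0" using empty.prems(3) by simp
  qed
next
  case (insert s S)
  show ?case
  proof
    fix \<gamma> assume \<gamma>: "\<gamma> \<in> A"
    define B where "B n = {\<alpha>\<in>A. \<alpha> s = n}" for n
    define N where "N = Max ((\<lambda>\<alpha>. \<alpha> s) ` A)"
    have N: "\<alpha> s \<le> N" if "\<alpha> \<in> A" for \<alpha>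
      unfolding N_def using that insert.prems(1) by auto
    have "\<forall>\<alpha>\<in>B (\<gamma> s). b \<alpha> = 0"
    proof (rule insert.IH)
      show "finite (B (\<gamma> s))" using insert.prems(1) by (simp add: B_def)
      show "\<forall>\<alpha>\<in>B (\<gamma> s). \<forall>\<beta>\<in>B (\<gamma> s). (\<forall>j\<in>S. \<alpha> j = \<beta> j) \<longrightarrow> \<alpha> = \<beta>"
        using insert.prems(2) by (simp add: B_def)
      show "\<forall>x. (\<Sum>\<alpha>\<in>B (\<gamma> s). b \<alpha> * (\<Prod>j\<in>S. x j ^ \<alpha> j)) = 0"
      proof
        fix x :: "'n \<Rightarrow> real"
        define c where "c n = (\<Sum>\<alpha>\<in>B n. b \<alpha> * (\<Prod>j\<in>S. x j ^ \<alpha> j))" for n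
        have "(\<Sum>n\<le>N. c n * t ^ n) = 0" for t
        proof -
          have pr: "(\<Prod>j\<in>S. (x(s := t)) j ^ \<alpha> j) = (\<Prod>j\<in>S. x j ^ \<alpha> j)" for \<alpha> :: "'n \<Rightarrow> nat"
            using insert.hyps(2) by (intro prod.cong) auto
          have "(\<Sum>n\<le>N. c n * t ^ n) =
                (\<Sum>n\<le>N. \<Sum>\<alpha>\<in>B n. b \<alpha> * (\<Prod>j\<in>S. x j ^ \<alpha> j) * t ^ \<alpha> s)"
            unfolding c_def sum_distrib_right by (intro sum.cong refl) (auto simp: B_def)
          also have "\<dots> = (\<Sum>\<alpha>\<in>A. b \<alpha> * (\<Prod>j\<in>S. x j ^ \<alpha> j) * t ^ \<alpha> s)"
            unfolding B_def using insert.prems(1) N by (intro sum.group) auto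
          also have "\<dots> = (\<Sum>\<alpha>\<in>A. b \<alpha> * (\<Prod>j\<in>insert s S. (x(s := t)) j ^ \<alpha> j))"
            by (intro sum.cong refl, subst prod.insert)
               (use insert.hyps pr in \<open>simp_all add: mult_ac\<close>)
          also have "\<dots> = 0" using insert.prems(3) by blast
          finally show ?thesis .
        qed
        then have "c (\<gamma> s) = 0" using N[OF \<gamma>] polyfun_eq_0[of c N] by blast
        then show "(\<Sum>\<alpha>\<in>B (\<gamma> s). b \<alpha> * (\<Prod>j\<in>S. x j ^ \<alpha> j)) = 0" by (simp add: c_def)
      qed
    qed
    then show "b \<gamma> = 0" using \<gamma> by (simp add: B_def)
  qed
qed

lemma coeffs_of_unique:
  fixes P :: "real ^ 'n::finite \<Rightarrow> real"
  assumes "coeffs_of m P b" "coeffs_of m P c"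
  shows "b = c"
proof -
  have "\<forall>\<alpha>\<in>multi_indices m. b \<alpha> - c \<alpha> = 0"
  proof (rule monomials_independent[OF finite_class.finite_UNIV finite_multi_indices])
    show "\<forall>\<alpha>\<in>multi_indices m. \<forall>\<beta>\<in>multi_indices m. (\<forall>j\<in>(UNIV::'n set). \<alpha> j = \<beta> j) \<longrightarrow> \<alpha> = \<beta>"
      by auto
    show "\<forall>x. (\<Sum>\<alpha>\<in>multi_indices m. (b \<alpha> - c \<alpha>) * (\<Prod>j\<in>(UNIV::'n set). x j ^ \<alpha> j)) = 0"
    proof
      fix x :: "'n \<Rightarrow> real"
      have "(\<Sum>\<alpha>\<in>multi_indices m. b \<alpha> * monomial_fun \<alpha> (\<chi> j. x j)) =
            (\<Sum>\<alpha>\<in>multi_indices m. c \<alpha> * monomial_fun \<alpha> (\<chi> j. x j))"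
        using assms unfolding coeffs_of_def by metis
      then show "(\<Sum>\<alpha>\<in>multi_indices m. (b \<alpha> - c \<alpha>) * (\<Prod>j\<in>UNIV. x j ^ \<alpha> j)) = 0"
        by (simp add: monomial_fun_def left_diff_distrib sum_subtractf)
    qed
  qed
  then show ?thesis
    using assms by (intro ext) (metis coeffs_of_def eq_iff_diff_eq_0)
qed

lemma hom_coeff_eq: "coeffs_of m P b \<Longrightarrow> hom_coeff m P = b"
  unfolding hom_coeff_def by (rule the_equality) (auto intro: coeffs_of_unique)

end

theory Submission
  imports Defs "HOL-Real_Asymp.Real_Asymp"
begin

text \<open>
  Only the monomials \<open>x\<^sup>2\<^sup>j y\<^sup>2\<^sup>k\<^sup>-\<^sup>2\<^sup>j\<close> occur in \<open>P\<^sub>m\<close>, with coefficient \<open>\<plusminus>(k choose j)\<close>. Since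
  \<open>(2j)! = 4\<^sup>j j! (1/2)\<^sub>j\<close>, the resulting sum \<open>\<Sum>\<^sub>j (k choose j)\<^sup>2 (2j)! (2k - 2j)!\<close> is the
  Vandermonde convolution \<open>(1/2 + 1/2)\<^sub>k\<close> of Pochhammer symbols, up to the factor \<open>4\<^sup>k k!\<close>.
  The square of the value \<open>4\<^sup>k / (2k choose k)\<close> is \<open>2k + 1\<close> times the \<open>k\<close>-th Wallis product,
  which gives the asymptotics.
\<close>

section \<open>Central binomial coefficients: convolution, lower bound and growth\<close>

lemma sum_binomial_sq_fact_double:
  "(\<Sum>j\<le>k. (real (k choose j))\<^sup>2 * fact (2 * j) * fact (2 * (k - j))) = 4 ^ k * (fact k)\<^sup>2"
proof -
  have summand: "(real (k choose j))\<^sup>2 * fact (2 * j) * fact (2 * (k - j)) =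
      4 ^ k * fact k * (real (k choose j) * pochhammer (1/2) j * pochhammer (1/2) (k - j))"
    if "j \<le> k" for j
  proof -
    \<comment> \<open>One of the two binomial factors absorbs \<open>j!\<close> and
      \<open>(k - j)!\<close> into \<open>k!\<close>; the other stays as the weight of the
      Vandermonde sum.\<close>
    have "(4::real) ^ k = 4 ^ j * 4 ^ (k - j)"
      using that by (simp flip: power_add)
    moreover have "real (k choose j) * (fact j * fact (k - j)) = fact k"
      using that by (simp add: binomial_fact)
    ultimately show ?thesis
      unfolding fact_double power_mult by (simp add: power2_eq_square mult_ac)
  qed
  have "(\<Sum>j\<le>k. (real (k choose j))\<^sup>2 * fact (2 * j) * fact (2 * (k - j))) =
      4 ^ k * fact k * (\<Sum>j\<le>k. real (k choose j) * pochhammer (1/2) j * pochhammer (1/2) (k - j))"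
    unfolding sum_distrib_left by (intro sum.cong) (auto simp: summand)
  also have "\<dots> = 4 ^ k * fact k * pochhammer (1/2 + 1/2) k"
    by (simp only: pochhammer_binomial_sum)
  finally show ?thesis
    by (simp add: power2_eq_square flip: pochhammer_fact)
qed

lemma four_pow_div_central_binomial:
  "4 ^ k / real ((2 * k) choose k) = 4 ^ k * (fact k)\<^sup>2 / fact (2 * k)"
  by (simp add: binomial_fact power2_eq_square mult_2)

text \<open>Row \<open>2k\<close> of Pascal's triangle sums to \<open>4 ^ k\<close>. For k \<ge> 1
  its entry 1 at position 0 is distinct from the central one, which makes the inequality
  strict.\<close>

lemma central_binomial_less_four_pow:
  assumes "k \<ge> 1"
  shows "(2 * k) choose k < 4 ^ k"
proof -
  have "(\<Sum>j\<in>{0, k}. (2 * k) choose j) \<le> (\<Sum>j\<le>2 * k. (2 * k) choose j)"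
    by (intro sum_mono2) auto
  then show ?thesis
    using assms by (simp add: choose_row_sum power_mult)
qed

lemma square_four_pow_div_central_binomial:
  "(4 ^ k / real ((2 * k) choose k))\<^sup>2 =
     (2 * real k + 1) * (\<Prod>j=1..k. (4 * real j ^ 2) / (4 * real j ^ 2 - 1))"
proof (induction k)
  case 0
  show ?case by simp
next
  case (Suc k)
  define a where "a = 4 ^ k / real ((2 * k) choose k)"
  define W where "W = (\<Prod>j=1..k. (4 * real j ^ 2) / (4 * real j ^ 2 - 1))"
  have "4 ^ Suc k / real ((2 * Suc k) choose Suc k) = a * ((2 * real k + 2) / (2 * real k + 1))"
    unfolding a_def four_pow_div_central_binomial
    by (simp add: divide_simps power2_eq_square) (simp add: algebra_simps)
  then have "(4 ^ Suc k / real ((2 * Suc k) choose Suc k))\<^sup>2 =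
      a\<^sup>2 * ((2 * real k + 2) / (2 * real k + 1))\<^sup>2"
    by (simp only: power_mult_distrib)
  also have "a\<^sup>2 = (2 * real k + 1) * W"
    using Suc.IH by (simp add: a_def W_def)
  also have "(2 * real k + 1) * W * ((2 * real k + 2) / (2 * real k + 1))\<^sup>2 =
      (2 * real (Suc k) + 1) * (W * ((4 * real (Suc k) ^ 2) / (4 * real (Suc k) ^ 2 - 1)))"
  proof -
    \<comment> \<open>In the new Wallis denominator, \<open>2k + 3\<close> cancels the new
      prefactor; the remaining \<open>2k + 1\<close> matches the left side after one cancellation
      there.\<close>
    have "4 * real (Suc k) ^ 2 - 1 = (2 * real k + 1) * (2 * real k + 3)"
      by (simp add: power2_eq_square algebra_simps)
    moreover have "2 * real k + 1 \<noteq> 0" "2 * real k + 3 \<noteq> 0"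
      by linarith+
    ultimately show ?thesis
      by (simp add: divide_simps power2_eq_square) (simp add: algebra_simps)
  qed
  also have "W * ((4 * real (Suc k) ^ 2) / (4 * real (Suc k) ^ 2 - 1)) =
      (\<Prod>j=1..Suc k. (4 * real j ^ 2) / (4 * real j ^ 2 - 1))"
    by (simp add: W_def)
  finally show ?case .
qed

lemma four_pow_div_central_binomial_asymp_equiv:
  "(\<lambda>k. 4 ^ k / real ((2 * k) choose k)) \<sim>[at_top] (\<lambda>k. sqrt (pi * real k))"
proof (rule asymp_equivI')
  define W where "W k = (\<Prod>j=1..k. (4 * real j ^ 2) / (4 * real j ^ 2 - 1))" for k
  have "(\<lambda>k. (2 * real k + 1) / (pi * real k)) \<longlonglongrightarrow> 2 / pi"
    by (real_asymp simp: field_simps)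
  then have "(\<lambda>k. sqrt ((2 * real k + 1) / (pi * real k) * W k)) \<longlonglongrightarrow> sqrt (2 / pi * (pi / 2))"
    unfolding W_def by (intro tendsto_real_sqrt tendsto_mult wallis)
  \<comment> \<open>This covers k = 0 as well: division by zero gives 0, so both sides are
    0.\<close>
  moreover have "4 ^ k / real ((2 * k) choose k) / sqrt (pi * real k) =
      sqrt ((2 * real k + 1) / (pi * real k) * W k)" for k
  proof -
    have "4 ^ k / real ((2 * k) choose k) = sqrt ((4 ^ k / real ((2 * k) choose k))\<^sup>2)"
      by simp
    also have "\<dots> = sqrt ((2 * real k + 1) * W k)"
      by (simp only: square_four_pow_div_central_binomial W_def)
    finally show ?thesis
      by (simp add: real_sqrt_divide[symmetric])
  qed
  ultimately show "(\<lambda>k. 4 ^ k / real ((2 * k) choose k) / sqrt (pi * real k)) \<longlonglongrightarrow> 1"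
    by simp
qed

section \<open>Coefficients and Bombieri-Weyl norm of \<open>(x^2 - y^2)^k\<close>\<close>

definition even_index :: "nat \<Rightarrow> nat \<Rightarrow> 2 \<Rightarrow> nat" where
  "even_index k j = (\<lambda>i. if i = 1 then 2 * j else 2 * (k - j))"

text \<open>The halved exponents recover \<open>k - j\<close> and \<open>j\<close>. The guard gives
  the value 0 at odd exponents and, as \<open>coeffs_of\<close> demands, outside the multi-indices
  of degree \<open>2k\<close>.\<close>

definition diff_sq_coeff :: "nat \<Rightarrow> (2 \<Rightarrow> nat) \<Rightarrow> real" where
  "diff_sq_coeff k \<alpha> =
     (if \<alpha> \<in> even_index k ` {..k} then (-1) ^ (\<alpha> 2 div 2) * real (k choose (\<alpha> 1 div 2)) else 0)"

lemma even_index_simps [simp]: "even_index k j 1 = 2 * j" "even_index k j 2 = 2 * (k - j)"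
  by (simp_all add: even_index_def)

lemma prod_UNIV_2: "(\<Prod>i\<in>UNIV. f i) = f 1 * f (2::2)"
  by (simp add: UNIV_2)

lemma inj_even_index: "inj_on (even_index k) A"
  by (rule inj_onI, drule fun_cong[where x = 1]) (simp add: even_index_def)

lemma even_index_in_multi_indices: "even_index k ` {..k} \<subseteq> multi_indices (2 * k)"
  by (auto simp: even_index_def multi_indices_def sum_2)

lemma diff_sq_coeff_even_index:
  "j \<le> k \<Longrightarrow> diff_sq_coeff k (even_index k j) = (-1) ^ (k - j) * real (k choose j)"
  by (auto simp: diff_sq_coeff_def)

text \<open>Serves both the polynomial identity and the norm: in each, the summand contains the
  coefficient or its square as a factor, so only the even indices contribute.\<close>

lemma sum_multi_indices_diff_sq_coeff:
  assumes "\<And>\<alpha>. diff_sq_coeff k \<alpha> = 0 \<Longrightarrow> f \<alpha> = 0"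
  shows "(\<Sum>\<alpha>\<in>multi_indices (2 * k). f \<alpha>) = (\<Sum>j\<le>k. f (even_index k j) :: real)"
proof -
  have "(\<Sum>\<alpha>\<in>multi_indices (2 * k). f \<alpha>) = (\<Sum>\<alpha>\<in>even_index k ` {..k}. f \<alpha>)"
    using assms
    by (intro sum.mono_neutral_right finite_multi_indices even_index_in_multi_indices)
       (simp add: diff_sq_coeff_def)
  then show ?thesis
    by (simp add: sum.reindex inj_even_index)
qed

lemma coeffs_of_diff_sq_pow: "coeffs_of (2 * k) (diff_sq_pow k) (diff_sq_coeff k)"
  unfolding coeffs_of_def
proof (intro conjI allI impI)
  show "diff_sq_coeff k \<alpha> = 0" if "\<alpha> \<notin> multi_indices (2 * k)" for \<alpha>
    using that even_index_in_multi_indices by (auto simp: diff_sq_coeff_def)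
  fix x :: "real ^ 2"
  have "(\<Sum>\<alpha>\<in>multi_indices (2 * k). diff_sq_coeff k \<alpha> * monomial_fun \<alpha> x) =
      (\<Sum>j\<le>k. diff_sq_coeff k (even_index k j) * monomial_fun (even_index k j) x)"
    by (rule sum_multi_indices_diff_sq_coeff) simp
  \<comment> \<open>The sign \<open>(-1) ^ (k - j)\<close> moves into the power of
    \<open>-y^2\<close>, leaving a plain binomial expansion.\<close>
  also have "\<dots> = (\<Sum>j\<le>k. real (k choose j) * ((x $ 1)\<^sup>2) ^ j * (- (x $ 2)\<^sup>2) ^ (k - j))"
    by (intro sum.cong refl)
       (simp add: diff_sq_coeff_even_index monomial_fun_def prod_UNIV_2
         power_mult power_minus[of "(x $ 2)\<^sup>2"])
  also have "\<dots> = ((x $ 1)\<^sup>2 + - (x $ 2)\<^sup>2) ^ k"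
    by (simp only: binomial_ring)
  finally show "diff_sq_pow k x =
      (\<Sum>\<alpha>\<in>multi_indices (2 * k). diff_sq_coeff k \<alpha> * monomial_fun \<alpha> x)"
    by (simp add: diff_sq_pow_def)
qed

lemma bw_norm_diff_sq_pow:
  "bw_norm (2 * k) (diff_sq_pow k) = sqrt (4 ^ k / real ((2 * k) choose k))"
proof -
  have "(\<Sum>\<alpha>\<in>multi_indices (2 * k).
        (\<Prod>i\<in>UNIV. fact (\<alpha> i)) / fact (2 * k) * \<bar>diff_sq_coeff k \<alpha>\<bar>\<^sup>2) =
      (\<Sum>j\<le>k. (\<Prod>i\<in>UNIV. fact (even_index k j i)) / fact (2 * k) *
        \<bar>diff_sq_coeff k (even_index k j)\<bar>\<^sup>2)"
    by (rule sum_multi_indices_diff_sq_coeff) simp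
  \<comment> \<open>The alternating signs disappear under the absolute value.\<close>
  also have "\<dots> = (\<Sum>j\<le>k. (real (k choose j))\<^sup>2 * fact (2 * j) * fact (2 * (k - j))) / fact (2 * k)"
    unfolding sum_divide_distrib
    by (intro sum.cong refl)
       (simp add: diff_sq_coeff_even_index prod_UNIV_2 abs_mult power_mult_distrib)
  also have "\<dots> = 4 ^ k / real ((2 * k) choose k)"
    by (simp only: sum_binomial_sq_fact_double four_pow_div_central_binomial)
  finally show ?thesis
    by (simp add: bw_norm_def hom_coeff_eq[OF coeffs_of_diff_sq_pow])
qed

section \<open>Supremum norm on the unit balls\<close>

text \<open>For finite p, the power of a single coordinate is bounded by the whole sum, and a
  positive exponent keeps any base above 1 above 1. This is applied once to the outer root and once
  to the coordinate.\<close>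

lemma abs_component_le_1:
  fixes x :: "real ^ 'n::finite"
  assumes "1 \<le> p" "lp_norm p x \<le> 1"
  shows "\<bar>x $ i\<bar> \<le> 1"
proof (cases "p = \<infinity>")
  case True
  then show ?thesis
    using assms component_le_infnorm_cart[of x i] by (simp add: lp_norm_def)
next
  case False
  then obtain r where r: "p = ereal r" "r \<ge> 1"
    using assms(1) by (cases p) auto
  define S where "S = (\<Sum>j\<in>UNIV. \<bar>x $ j\<bar> powr r)"
  have "S powr (1 / r) \<le> 1"
    using assms(2) r by (simp add: lp_norm_def S_def)
  moreover have "1 < S powr (1 / r)" if "S > 1"
    using that r by simp
  ultimately have "S \<le> 1"
    by linarith
  moreover have "\<bar>x $ i\<bar> powr r \<le> S"
    unfolding S_def by (rule member_le_sum) auto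
  moreover have "1 < \<bar>x $ i\<bar> powr r" if "\<bar>x $ i\<bar> > 1"
    using that r by simp
  ultimately show ?thesis
    by linarith
qed

lemma lp_norm_axis_1: "1 \<le> p \<Longrightarrow> lp_norm p (axis 1 1 :: real ^ 2) = 1"
  by (auto simp: lp_norm_def sum_2 axis_def infnorm_2)

lemma lp_sup_norm_diff_sq_pow:
  assumes "1 \<le> p"
  shows "lp_sup_norm p (diff_sq_pow k) = 1"
  unfolding lp_sup_norm_def
proof (rule cSup_eq_maximum)
  have "\<bar>diff_sq_pow k (axis 1 1)\<bar> = 1"
    by (simp add: diff_sq_pow_def axis_def)
  then show "1 \<in> (\<lambda>x. \<bar>diff_sq_pow k x\<bar>) ` {x. lp_norm p x \<le> 1}"
    using lp_norm_axis_1[OF assms] by (intro image_eqI[of _ _ "axis 1 1"]) auto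
next
  fix y assume "y \<in> (\<lambda>x. \<bar>diff_sq_pow k x\<bar>) ` {x. lp_norm p x \<le> 1}"
  then obtain x where x: "lp_norm p x \<le> 1" "y = \<bar>diff_sq_pow k x\<bar>"
    by auto
  \<comment> \<open>Both squares lie in [0, 1], so their difference lies in [-1, 1], uniformly in
    p.\<close>
  have "(x $ i)\<^sup>2 \<le> 1" for i
    using abs_component_le_1[OF assms x(1)] by (simp add: abs_square_le_1)
  then have "\<bar>(x $ 1)\<^sup>2 - (x $ 2)\<^sup>2\<bar> \<le> 1"
    by (smt (verit) zero_le_power2)
  then show "y \<le> 1"
    by (simp add: x(2) diff_sq_pow_def power_abs power_le_one)
qed

theorem proposition6p1:
  shows "(\<forall>k::nat. k \<ge> 1 \<longrightarrow>
            hom_poly (2 * k) (diff_sq_pow k) \<and>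
            (\<forall>p::ereal. 1 \<le> p \<longrightarrow> lp_sup_norm p (diff_sq_pow k) = 1) \<and>
            (bw_norm (2 * k) (diff_sq_pow k))\<^sup>2 = 4 ^ k / real ((2 * k) choose k) \<and>
            4 ^ k / real ((2 * k) choose k) > 1) \<and>
         (\<forall>(m::nat) (p::ereal). even m \<and> m \<ge> 2 \<and> 1 \<le> p \<longrightarrow>
            (\<exists>P :: real ^ 2 \<Rightarrow> real. hom_poly m P \<and> \<not> bw_norm m P \<le> lp_sup_norm p P)) \<and>
         (\<lambda>k::nat. bw_norm (2 * k) (diff_sq_pow k)) \<sim>[at_top] (\<lambda>k. (pi * real k) powr (1 / 4))"
proof (intro conjI allI impI; (elim conjE)?)
  show hom: "hom_poly (2 * k) (diff_sq_pow k)" for k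
    using coeffs_of_diff_sq_pow unfolding hom_poly_def by blast
  show "lp_sup_norm p (diff_sq_pow k) = 1" if "1 \<le> p" for k p
    using that by (rule lp_sup_norm_diff_sq_pow)
  show "(bw_norm (2 * k) (diff_sq_pow k))\<^sup>2 = 4 ^ k / real ((2 * k) choose k)" for k
    by (simp add: bw_norm_diff_sq_pow)
  show gt1: "4 ^ k / real ((2 * k) choose k) > 1" if "k \<ge> 1" for k
  proof -
    have "real ((2 * k) choose k) < real (4 ^ k)"
      using central_binomial_less_four_pow[OF that] by (simp only: of_nat_less_iff)
    then show ?thesis
      by simp
  qed
  show "\<exists>P :: real ^ 2 \<Rightarrow> real. hom_poly m P \<and> \<not> bw_norm m P \<le> lp_sup_norm p P"
    if m: "even m" "m \<ge> 2" and p: "1 \<le> p" for m p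
  proof -
    from m obtain k where k: "m = 2 * k" "k \<ge> 1"
      by auto
    have "bw_norm m (diff_sq_pow k) > 1"
      using gt1[OF k(2)] by (simp only: k(1) bw_norm_diff_sq_pow real_sqrt_gt_1_iff)
    then show ?thesis
      using hom[of k] lp_sup_norm_diff_sq_pow[OF p, of k] k(1) by (metis not_le)
  qed
  \<comment> \<open>The norm is the square root of the quotient, and the quotient grows like
    \<open>sqrt (pi * k)\<close>. Nonnegativity of both sides lets the equivalence pass to the power
    1/2, whence the exponent 1/4.\<close>
  have "(\<lambda>k. (4 ^ k / real ((2 * k) choose k)) powr (1/2)) \<sim>[at_top]
      (\<lambda>k. sqrt (pi * real k) powr (1/2))"
    by (intro asymp_equiv_powr_real four_pow_div_central_binomial_asymp_equiv) auto
  moreover have "sqrt (pi * real k) powr (1/2) = (pi * real k) powr (1/4)" for k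
    by (simp add: powr_half_sqrt[symmetric] powr_powr)
  ultimately show "(\<lambda>k. bw_norm (2 * k) (diff_sq_pow k)) \<sim>[at_top] (\<lambda>k. (pi * real k) powr (1/4))"
    by (simp add: bw_norm_diff_sq_pow powr_half_sqrt)
qed

end
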